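(* Let $(G,\tau,\oplus)$ be a (Hausdorff) strongly topological gyrogroup with a symmetric neighborhood base $\mathscr U$ at $0$, and let $H$ be an admissible subgyrogroup of $G$ generated from $\mathscr U$. If $H$ is neutral, then $\pi\omega(G/H)=\omega(G/H)$, i.e. the $\pi$-weight and the weight of the quotient space $G/H$ coincide.
   Context: A groupoid is a nonempty set with a binary operation; $\mathrm{Aut}(G,\oplus)$ is the set of bijective maps $f:G\to G$ with $f(x\oplus y)=f(x)\oplus f(y)$. A gyrogroup is a groupoid $(G,\oplus)$ such that: (G1) there is a unique $0\in G$ with $0\oplus a=a=a\oplus 0$ for all $a\in G$; (G2) each $x\in G$ has a unique inverse $\ominus x\in G$ with $\ominus x\oplus x=0=x\oplus(\ominus x)$; (G3) for all $x,y\in G$ there is $\mathrm{gyr}[x,y]\in\mathrm{Aut}(G,\oplus)$ with $x\oplus(y\oplus z)=(x\oplus y)\oplus\mathrm{gyr}[x,y](z)$ for all $z\in G$; (G4) $\mathrm{gyr}[x\oplus y,y]=\mathrm{gyr}[x,y]$ for all $x,y\in G$. For $A,B\subset G$, $A\oplus B=\{a\oplus b:a\in A,b\in B\}$ and $\ominus A=\{\ominus a:a\in A\}$; $A$ is symmetric if $\ominus A=A$. A nonempty $H\subset G$ is a subgyrogroup if $\oplus$ restricts to a binary operation on $H$, for all $x,y\in H$ the restriction $\mathrm{gyr}[x,y]|_H:H\to\mathrm{gyr}[x,y](H)$ is a bijective homomorphism, and $(H,\oplus|_{H\times H})$ is a gyrogroup. It is an $L$-subgyrogroup if moreover $\mathrm{gyr}[a,h](H)=H$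 for all $a\in G$, $h\in H$. A topological gyrogroup is a gyrogroup with a topology $\tau$ such that $\oplus:G\times G\to G$ is jointly continuous and $x\mapsto\ominus x$ is continuous. It is a strongly topological gyrogroup with neighborhood base $\mathscr U$ at $0$ if $\mathscr U$ is a neighborhood base at $0$ with $\mathrm{gyr}[x,y](U)=U$ for all $U\in\mathscr U$ and $x,y\in G$; $\mathscr U$ is symmetric if every $U\in\mathscr U$ is symmetric. A subgyrogroup $H$ of $G$ is admissible if there is a sequence $\{U_n:n\in\omega\}$ of open symmetric neighborhoods of $0$ with $U_{n+1}\oplus(U_{n+1}\oplus U_{n+1})\subset U_n$ for all $n\in\omega$ and $H=\bigcap_{n\in\omega}U_n$; it is generated from $\mathscr U$ if such a sequence can be taken with each $U_n\in\mathscr U$. (Such an $H$ is known to be a closed $L$-subgyrogroup.) For an $L$-subgyrogroup $H$, $G/H=\{a\oplus H:a\in G\}$ is a partition of $G$; $\pi:G\to G/H$, $\pi(a)=a\oplus H$, and $G/H$ carries the quotient topology ($O$ is open iff $\pi^{-1}(O)$ is open in $G$). All topological spaces are assumed Hausdorff. An $L$-subgyrogroup $H$ of $G$ is neutral if for every open neighborhood $U$ of $0$ in $G$ there is an open neighborhood $V$ of $0$ with $H\oplus V\subset U\oplus H$. For a space $X$: $\omega(X)$ (weight) is the least cardinality of a base of $X$; $\pi\omega(X)$ ($\pi$-weight) is the least cardinality of a $\pi$-base of $X$, i.e. a family of nonempty open subsets of $X$ such that every nonempty open subset of $X$ contains a member of the family. *)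

theory Defs
  imports "HOL-Analysis.Analysis"
begin

unbundle cardinal_syntax

section \<open>Gyrogroups\<close>

locale groupoid =
  fixes G :: "'a set" and add :: "'a \<Rightarrow> 'a \<Rightarrow> 'a"  (infixl \<open>\<oplus>\<close> 65)
  assumes nonempty: "G \<noteq> {}"
    and closed: "\<lbrakk>x \<in> G; y \<in> G\<rbrakk> \<Longrightarrow> x \<oplus> y \<in> G"
begin

definition is_zero :: "'a \<Rightarrow> bool" where
  "is_zero e \<longleftrightarrow> e \<in> G \<and> (\<forall>a\<in>G. e \<oplus> a = a \<and> a \<oplus> e = a)"

definition zero :: 'a where
  "zero = (THE e. is_zero e)"

definition is_inverse :: "'a \<Rightarrow> 'a \<Rightarrow> bool" where
  "is_inverse x y \<longleftrightarrow> y \<in> G \<and> y \<oplus> x = zero \<and> x \<oplus> y = zero"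

definition neg :: "'a \<Rightarrow> 'a" where
  "neg x = (THE y. is_inverse x y)"

definition Aut :: "('a \<Rightarrow> 'a) set" where
  "Aut = {f. bij_betw f G G \<and> (\<forall>x\<in>G. \<forall>y\<in>G. f (x \<oplus> y) = f x \<oplus> f y)}"

definition set_add :: "'a set \<Rightarrow> 'a set \<Rightarrow> 'a set" where
  "set_add A B = {a \<oplus> b | a b. a \<in> A \<and> b \<in> B}"

definition symmetric :: "'a set \<Rightarrow> bool" where
  "symmetric A \<longleftrightarrow> neg ` A = A"

definition coset :: "'a set \<Rightarrow> 'a \<Rightarrow> 'a set" where
  "coset H a = (\<lambda>h. a \<oplus> h) ` H"

definition cosets :: "'a set \<Rightarrow> 'a set set" where
  "cosets H = coset H ` G"

end

text \<open>The gyration is a parameter of the locale; on \<open>G\<close> it is determined by the operation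
  (left cancellation), and its values outside \<open>G\<close> are irrelevant.\<close>

locale gyrogroup = groupoid G add
  for G :: "'a set" and add :: "'a \<Rightarrow> 'a \<Rightarrow> 'a"  (infixl \<open>\<oplus>\<close> 65) +
  fixes gyr :: "'a \<Rightarrow> 'a \<Rightarrow> 'a \<Rightarrow> 'a"
  assumes G1: "\<exists>!e. is_zero e"
    and G2: "x \<in> G \<Longrightarrow> \<exists>!y. is_inverse x y"
    and gyr_Aut: "\<lbrakk>x \<in> G; y \<in> G\<rbrakk> \<Longrightarrow> gyr x y \<in> Aut"
    and G3: "\<lbrakk>x \<in> G; y \<in> G; z \<in> G\<rbrakk> \<Longrightarrow> x \<oplus> (y \<oplus> z) = (x \<oplus> y) \<oplus> gyr x y z"
    and G4: "\<lbrakk>x \<in> G; y \<in> G; z \<in> G\<rbrakk> \<Longrightarrow> gyr (x \<oplus> y) y z = gyr x y z"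
begin

text \<open>The last conjunct lets \<open>H\<close> carry a gyration of its own, which is not required beforehand
  to be the restriction of that of \<open>G\<close>.\<close>

definition subgyrogroup :: "'a set \<Rightarrow> bool" where
  "subgyrogroup H \<longleftrightarrow> H \<noteq> {} \<and> H \<subseteq> G \<and> (\<forall>x\<in>H. \<forall>y\<in>H. x \<oplus> y \<in> H) \<and>
     (\<forall>x\<in>H. \<forall>y\<in>H. bij_betw (gyr x y) H (gyr x y ` H) \<and>
        (\<forall>a\<in>H. \<forall>b\<in>H. gyr x y (a \<oplus> b) = gyr x y a \<oplus> gyr x y b)) \<and>
     (\<exists>gyr'. gyrogroup H (\<oplus>) gyr')"

definition L_subgyrogroup :: "'a set \<Rightarrow> bool" where
  "L_subgyrogroup H \<longleftrightarrow> subgyrogroup H \<and> (\<forall>a\<in>G. \<forall>h\<in>H. gyr a h ` H = H)"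

end

section \<open>Topological gyrogroups\<close>

locale topological_gyrogroup = gyrogroup "topspace \<tau>" add gyr
  for \<tau> :: "'a topology" and add :: "'a \<Rightarrow> 'a \<Rightarrow> 'a"  (infixl \<open>\<oplus>\<close> 65)
    and gyr :: "'a \<Rightarrow> 'a \<Rightarrow> 'a \<Rightarrow> 'a" +
  assumes continuous_add: "continuous_map (prod_topology \<tau> \<tau>) \<tau> (\<lambda>(x, y). x \<oplus> y)"
    and continuous_neg: "continuous_map \<tau> \<tau> neg"
begin

text \<open>\<^const>\<open>neighbourhood_base_at\<close> alone does not require the members of the family
  to be neighbourhoods. They need not be open.\<close>

definition nbhd_base_zero :: "'a set set \<Rightarrow> bool" where
  "nbhd_base_zero \<U> \<longleftrightarrow>
     (\<forall>U\<in>\<U>. U \<subseteq> topspace \<tau> \<and> (\<exists>V. openin \<tau> V \<and> zero \<in> V \<and> V \<subseteq> U)) \<and>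
     neighbourhood_base_at zero (\<lambda>U. U \<in> \<U>) \<tau>"

text \<open>Membership \<open>U n \<in> \<U>\<close> is the condition that the admissible subgyrogroup is generated from \<open>\<U>\<close>.\<close>

definition admissible_from :: "'a set set \<Rightarrow> 'a set \<Rightarrow> bool" where
  "admissible_from \<U> H \<longleftrightarrow> subgyrogroup H \<and>
     (\<exists>U :: nat \<Rightarrow> 'a set.
        (\<forall>n. openin \<tau> (U n) \<and> zero \<in> U n \<and> symmetric (U n) \<and> U n \<in> \<U>) \<and>
        (\<forall>n. set_add (U (Suc n)) (set_add (U (Suc n)) (U (Suc n))) \<subseteq> U n) \<and>
        H = (\<Inter>n. U n))"

definition neutral :: "'a set \<Rightarrow> bool" where
  "neutral H \<longleftrightarrow> L_subgyrogroup H \<and>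
     (\<forall>U. openin \<tau> U \<and> zero \<in> U \<longrightarrow>
        (\<exists>V. openin \<tau> V \<and> zero \<in> V \<and> set_add H V \<subseteq> set_add U H))"

definition quotient_space :: "'a set \<Rightarrow> 'a set topology" where
  "quotient_space H =
     topology (\<lambda>W. W \<subseteq> cosets H \<and> openin \<tau> {a \<in> topspace \<tau>. coset H a \<in> W})"

lemma openin_quotient_space:
  "openin (quotient_space H) W \<longleftrightarrow>
     W \<subseteq> cosets H \<and> openin \<tau> {a \<in> topspace \<tau>. coset H a \<in> W}"
proof -
  have "istopology (\<lambda>W. W \<subseteq> cosets H \<and> openin \<tau> {a \<in> topspace \<tau>. coset H a \<in> W})"
    (is "istopology ?L")
    unfolding istopology_def
  proof (intro conjI allI impI)
    fix S T assume "?L S" "?L T"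
    moreover have "{a \<in> topspace \<tau>. coset H a \<in> S \<inter> T} =
        {a \<in> topspace \<tau>. coset H a \<in> S} \<inter> {a \<in> topspace \<tau>. coset H a \<in> T}"
      by blast
    ultimately show "S \<inter> T \<subseteq> cosets H"
      and "openin \<tau> {a \<in> topspace \<tau>. coset H a \<in> S \<inter> T}"
      by auto
  next
    fix \<K> assume *: "\<forall>K\<in>\<K>. ?L K"
    then show "\<Union>\<K> \<subseteq> cosets H" by blast
    have "{a \<in> topspace \<tau>. coset H a \<in> \<Union>\<K>} =
        (\<Union>K\<in>\<K>. {a \<in> topspace \<tau>. coset H a \<in> K})"
      by blast
    then show "openin \<tau> {a \<in> topspace \<tau>. coset H a \<in> \<Union>\<K>}"
      using * by auto
  qed
  then show ?thesis
    by (simp add: quotient_space_def topology_inverse')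
qed

lemma topspace_quotient_space: "topspace (quotient_space H) = cosets H"
proof (rule topspace_def[THEN trans], intro equalityI Union_least Union_upper)
  have "{a \<in> topspace \<tau>. coset H a \<in> cosets H} = topspace \<tau>"
    by (auto simp: cosets_def)
  then show "cosets H \<in> {S. openin (quotient_space H) S}"
    by (simp add: openin_quotient_space)
qed (simp add: openin_quotient_space)

lemma quotient_map_coset: "quotient_map \<tau> (quotient_space H) (coset H)"
  unfolding quotient_map_def topspace_quotient_space
  by (auto simp: cosets_def openin_quotient_space)

end

locale strongly_topological_gyrogroup = topological_gyrogroup \<tau> add gyr
  for \<tau> :: "'a topology" and add :: "'a \<Rightarrow> 'a \<Rightarrow> 'a"  (infixl \<open>\<oplus>\<close> 65)
    and gyr :: "'a \<Rightarrow> 'a \<Rightarrow> 'a \<Rightarrow> 'a" +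
  fixes \<U> :: "'a set set"
  assumes base: "nbhd_base_zero \<U>"
    and gyr_invariant:
      "\<lbrakk>U \<in> \<U>; x \<in> topspace \<tau>; y \<in> topspace \<tau>\<rbrakk> \<Longrightarrow> gyr x y ` U = U"
begin

lemma admissible_from_imp_L_subgyrogroup:
  assumes "admissible_from \<U> H"
  shows "L_subgyrogroup H"
proof -
  from assms obtain U :: "nat \<Rightarrow> 'a set"
    where sub: "subgyrogroup H"
      and U: "\<And>n. openin \<tau> (U n)" "\<And>n. U n \<in> \<U>"
      and H: "H = (\<Inter>n. U n)"
    unfolding admissible_from_def by metis
  have "gyr a h ` H = H" if "a \<in> topspace \<tau>" "h \<in> H" for a h
  proof -
    have h: "h \<in> topspace \<tau>"
      using that(2) H openin_subset[OF U(1)] by blast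
    then have "inj_on (gyr a h) (topspace \<tau>)"
      using gyr_Aut[OF that(1)] by (auto simp: Aut_def bij_betw_def)
    then have "gyr a h ` (\<Inter>n. U n) = (\<Inter>n. gyr a h ` U n)"
      by (rule image_INT[where j = 0]) (intro ballI openin_subset U, rule UNIV_I)
    then show ?thesis
      using gyr_invariant[OF U(2) that(1) h] H by simp
  qed
  with sub show ?thesis
    by (simp add: L_subgyrogroup_def)
qed

end

section \<open>Weight and \<open>\<pi>\<close>-weight\<close>

definition is_base :: "'a topology \<Rightarrow> 'a set set \<Rightarrow> bool" where
  "is_base X \<B> \<longleftrightarrow> (\<forall>V\<in>\<B>. openin X V) \<and>
     (\<forall>U x. openin X U \<and> x \<in> U \<longrightarrow> (\<exists>V\<in>\<B>. x \<in> V \<and> V \<subseteq> U))"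

definition is_pi_base :: "'a topology \<Rightarrow> 'a set set \<Rightarrow> bool" where
  "is_pi_base X \<B> \<longleftrightarrow> (\<forall>V\<in>\<B>. openin X V \<and> V \<noteq> {}) \<and>
     (\<forall>U. openin X U \<and> U \<noteq> {} \<longrightarrow> (\<exists>V\<in>\<B>. V \<subseteq> U))"

text \<open>The cardinal of a set in the family of least cardinality. Cardinals are well-orders, so
  they are to be compared by \<open>=o\<close>.\<close>

definition least_card :: "'b set set \<Rightarrow> 'b rel" where
  "least_card \<A> =
     card_of (SOME A. A \<in> \<A> \<and> (\<forall>B\<in>\<A>. |A| \<le>o |B| ))"

definition weight :: "'a topology \<Rightarrow> 'a set rel" where
  "weight X = least_card {\<B>. is_base X \<B>}"

definition pi_weight :: "'a topology \<Rightarrow> 'a set rel" where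
  "pi_weight X = least_card {\<B>. is_pi_base X \<B>}"

lemma least_card:
  assumes "\<A> \<noteq> {}"
  obtains A where "A \<in> \<A>" "least_card \<A> = |A|" "\<And>B. B \<in> \<A> \<Longrightarrow> |A| \<le>o |B|"
proof -
  have "\<exists>r\<in>card_of ` \<A>. \<forall>r'\<in>card_of ` \<A>. r \<le>o r'"
    using assms by (intro exists_minim_Card_order) (auto simp: card_of_Card_order)
  then have "\<exists>A. A \<in> \<A> \<and> (\<forall>B\<in>\<A>. |A| \<le>o |B| )" by blast
  from someI_ex[OF this] show thesis
    by (intro that) (auto simp: least_card_def)
qed

lemma is_base_openin: "is_base X {U. openin X U}"
  by (auto simp: is_base_def)

lemma is_pi_base_openin: "is_pi_base X {U. openin X U \<and> U \<noteq> {}}"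
  by (auto simp: is_pi_base_def)

end

theory Submission
  imports Defs
begin

text \<open>Gyration invariance of the members of \<open>\<U>\<close>, and hence of \<open>H\<close>, makes complex sums
  associative whenever the third summand is one of these sets. Open sets of \<open>G/H\<close> correspond to
  open \<open>W \<subseteq> G\<close> with \<open>W \<oplus> H \<subseteq> W\<close>, and this class is closed under adding an arbitrary set on the
  left. If \<open>\<P>\<close> is a \<open>\<pi>\<close>-base, consisting of such sets, then the sets
  \<open>W\<^sub>1 \<oplus> (\<ominus>W\<^sub>2 \<oplus> W\<^sub>2)\<close> with \<open>W\<^sub>1, W\<^sub>2 \<in> \<P>\<close> form a base: neutrality makes \<open>\<ominus>W\<^sub>2 \<oplus> W\<^sub>2\<close> as small as
  desired modulo \<open>H\<close>, and then \<open>W\<^sub>1\<close> is chosen close to the given point. This settles infinite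
  \<open>\<P>\<close>; if \<open>\<P>\<close> is finite, there is a minimal nonempty open set, its translates cover \<open>G/H\<close>, and
  the minimal nonempty open sets, which all lie in \<open>\<P>\<close>, form a base.\<close>

section \<open>Algebra of gyrogroups\<close>

context groupoid
begin

lemma set_addI: "a \<in> A \<Longrightarrow> b \<in> B \<Longrightarrow> a \<oplus> b \<in> set_add A B"
  by (auto simp: set_add_def)

lemma set_add_mono: "A \<subseteq> A' \<Longrightarrow> B \<subseteq> B' \<Longrightarrow> set_add A B \<subseteq> set_add A' B'"
  by (fastforce simp: set_add_def)

lemma set_add_closed: "A \<subseteq> G \<Longrightarrow> B \<subseteq> G \<Longrightarrow> set_add A B \<subseteq> G"
  unfolding set_add_def using closed by blast

lemma set_add_UN: "set_add A B = (\<Union>a\<in>A. set_add {a} B)"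
  by (auto simp: set_add_def)

end

context gyrogroup
begin

lemma is_zero_zero: "is_zero zero"
  unfolding zero_def by (rule theI'[OF G1])

lemma zero_closed [simp]: "zero \<in> G"
  and zero_left [simp]: "a \<in> G \<Longrightarrow> zero \<oplus> a = a"
  and zero_right [simp]: "a \<in> G \<Longrightarrow> a \<oplus> zero = a"
  using is_zero_zero by (auto simp: is_zero_def)

lemma is_inverse_neg: "x \<in> G \<Longrightarrow> is_inverse x (neg x)"
  unfolding neg_def by (rule theI'[OF G2])

lemma neg_closed [simp]: "x \<in> G \<Longrightarrow> neg x \<in> G"
  and neg_left [simp]: "x \<in> G \<Longrightarrow> neg x \<oplus> x = zero"
  and neg_right [simp]: "x \<in> G \<Longrightarrow> x \<oplus> neg x = zero"
  using is_inverse_neg[of x] by (auto simp: is_inverse_def)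

lemma neg_neg [simp]:
  assumes "x \<in> G"
  shows "neg (neg x) = x"
proof -
  have "is_inverse (neg x) x"
    using assms by (simp add: is_inverse_def)
  moreover have "is_inverse (neg x) (neg (neg x))"
    using assms by (intro is_inverse_neg neg_closed)
  ultimately show ?thesis
    using G2[OF neg_closed[OF assms]] by blast
qed

lemma gyr_closed [simp]: "\<lbrakk>x \<in> G; y \<in> G; z \<in> G\<rbrakk> \<Longrightarrow> gyr x y z \<in> G"
  and gyr_add: "\<lbrakk>x \<in> G; y \<in> G; z \<in> G; w \<in> G\<rbrakk> \<Longrightarrow> gyr x y (z \<oplus> w) = gyr x y z \<oplus> gyr x y w"
  and gyr_inj: "\<lbrakk>x \<in> G; y \<in> G\<rbrakk> \<Longrightarrow> inj_on (gyr x y) G"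
  using gyr_Aut[of x y] by (auto simp: Aut_def bij_betw_def)

text \<open>Adding \<open>neg a\<close> on the left turns both sides into values of
  \<open>gyr (neg a) a\<close>, and this gyration is injective. That it is the identity follows only
  later, from this lemma.\<close>

lemma add_left_cancel:
  assumes "a \<in> G" "b \<in> G" "c \<in> G" "a \<oplus> b = a \<oplus> c"
  shows "b = c"
proof -
  have "gyr (neg a) a b = gyr (neg a) a c"
    using G3[of "neg a" a b] G3[of "neg a" a c] assms by simp
  then show ?thesis
    using gyr_inj[of "neg a" a] assms by (auto dest: inj_onD)
qed

lemma gyr_zero: "a \<in> G \<Longrightarrow> b \<in> G \<Longrightarrow> gyr zero a b = b"
  by (rule add_left_cancel[of a]) (use G3[of zero a b] in \<open>auto simp: closed\<close>)

text \<open>G4 with \<open>x = neg a\<close> and \<open>y = a\<close> identifies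
  \<open>gyr (neg a) a\<close> with \<open>gyr zero a\<close>, which is the identity on
  \<open>G\<close>.\<close>

lemma neg_add_cancel [simp]: "a \<in> G \<Longrightarrow> b \<in> G \<Longrightarrow> neg a \<oplus> (a \<oplus> b) = b"
  using G3[of "neg a" a b] G4[of "neg a" a b] gyr_zero by simp

lemma add_neg_cancel [simp]: "a \<in> G \<Longrightarrow> b \<in> G \<Longrightarrow> a \<oplus> (neg a \<oplus> b) = b"
  using neg_add_cancel[of "neg a" b] by simp

text \<open>Both sides are right inverses of \<open>a \<oplus> b\<close>, so left cancellation
  applies. The gyrations stay on the summands because gyration-invariant sets absorb them.\<close>

lemma neg_add:
  assumes "a \<in> G" "b \<in> G"
  shows "neg (a \<oplus> b) = gyr a b (neg b) \<oplus> gyr a b (neg a)"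
proof (rule add_left_cancel[of "a \<oplus> b"])
  have "(a \<oplus> b) \<oplus> gyr a b (neg b \<oplus> neg a) = zero"
    using G3[of a b "neg b \<oplus> neg a"] assms by (simp add: closed)
  then show "(a \<oplus> b) \<oplus> neg (a \<oplus> b) = (a \<oplus> b) \<oplus> (gyr a b (neg b) \<oplus> gyr a b (neg a))"
    using assms by (simp add: gyr_add closed)
qed (use assms in \<open>auto simp: closed\<close>)

definition gyr_invariant_set :: "'a set \<Rightarrow> bool" where
  "gyr_invariant_set S \<longleftrightarrow> S \<subseteq> G \<and> (\<forall>x\<in>G. \<forall>y\<in>G. gyr x y ` S = S)"

lemma gyr_invariant_set_mem:
  "\<lbrakk>gyr_invariant_set S; x \<in> G; y \<in> G; s \<in> S\<rbrakk> \<Longrightarrow> gyr x y s \<in> S"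
  unfolding gyr_invariant_set_def by blast

text \<open>In G3 the gyration acts on the third summand alone, so only \<open>S\<close> has to be
  invariant. One inclusion uses that gyrations map \<open>S\<close> onto \<open>S\<close>, the other
  that they map \<open>S\<close> into \<open>S\<close>.\<close>

lemma set_add_assoc:
  assumes "A \<subseteq> G" "B \<subseteq> G" and S: "gyr_invariant_set S"
  shows "set_add (set_add A B) S = set_add A (set_add B S)"
proof (intro equalityI subsetI)
  fix z assume "z \<in> set_add (set_add A B) S"
  then obtain a b s where z: "z = (a \<oplus> b) \<oplus> s" "a \<in> A" "b \<in> B" "s \<in> S"
    by (auto simp: set_add_def)
  then have G: "a \<in> G" "b \<in> G"
    using assms by auto
  then have "s \<in> gyr a b ` S"
    using S z(4) by (simp add: gyr_invariant_set_def)
  then obtain s' where s': "s' \<in> S" "s = gyr a b s'"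
    by blast
  then have "s' \<in> G"
    using S by (auto simp: gyr_invariant_set_def)
  then have "z = a \<oplus> (b \<oplus> s')"
    using G3[OF G, of s'] z(1) s'(2) by metis
  then show "z \<in> set_add A (set_add B S)"
    using z s' by (auto intro!: set_addI)
next
  fix z assume "z \<in> set_add A (set_add B S)"
  then obtain a b s where z: "z = a \<oplus> (b \<oplus> s)" "a \<in> A" "b \<in> B" "s \<in> S"
    by (auto simp: set_add_def)
  then have "a \<in> G" "b \<in> G" "s \<in> G"
    using assms S by (auto simp: gyr_invariant_set_def)
  then have "z = (a \<oplus> b) \<oplus> gyr a b s"
    using G3[of a b s] z(1) by metis
  moreover have "gyr a b s \<in> S"
    using z assms gyr_invariant_set_mem[OF S] by blast
  ultimately show "z \<in> set_add (set_add A B) S"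
    using z by (auto intro!: set_addI)
qed

text \<open>Inversion reverses the order as in a group: the gyrations of \<open>neg_add\<close>
  disappear in the invariant sets \<open>A\<close> and \<open>B\<close>.\<close>

lemma neg_set_add:
  assumes A: "gyr_invariant_set A" "neg ` A \<subseteq> A" and B: "gyr_invariant_set B" "neg ` B \<subseteq> B"
  shows "neg ` set_add A B \<subseteq> set_add B A"
proof
  fix z assume "z \<in> neg ` set_add A B"
  then obtain a b where z: "z = neg (a \<oplus> b)" "a \<in> A" "b \<in> B"
    by (auto simp: set_add_def)
  then have G: "a \<in> G" "b \<in> G"
    using A B unfolding gyr_invariant_set_def by auto
  have "gyr a b (neg b) \<in> B" "gyr a b (neg a) \<in> A"
    using z A B G by (auto intro!: gyr_invariant_set_mem)
  then show "z \<in> set_add B A"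
    using z G by (auto simp: neg_add intro!: set_addI)
qed

text \<open>Presents a left translate as a preimage under left addition of \<open>neg a\<close>, the
  form in which continuity yields openness.\<close>

lemma set_add_singleton:
  assumes "a \<in> G" "W \<subseteq> G"
  shows "set_add {a} W = {y \<in> G. neg a \<oplus> y \<in> W}"
proof (intro equalityI subsetI)
  fix y assume "y \<in> {y \<in> G. neg a \<oplus> y \<in> W}"
  then have y: "y \<in> G" "neg a \<oplus> y \<in> W"
    by auto
  then have "a \<oplus> (neg a \<oplus> y) \<in> set_add {a} W"
    by (intro set_addI) auto
  then show "y \<in> set_add {a} W"
    using y assms by simp
qed (use assms in \<open>auto simp: set_add_def closed subset_iff\<close>)

end

section \<open>Continuity\<close>

context topological_gyrogroup
begin

lemma continuous_map_add:
  assumes "continuous_map X \<tau> f" "continuous_map X \<tau> g"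
  shows "continuous_map X \<tau> (\<lambda>x. f x \<oplus> g x)"
proof -
  have "continuous_map X (prod_topology \<tau> \<tau>) (\<lambda>x. (f x, g x))"
    using assms by (intro continuous_map_pairedI)
  from continuous_map_compose[OF this continuous_add] show ?thesis
    by (simp add: comp_def)
qed

lemma openin_set_add_singleton:
  assumes "a \<in> topspace \<tau>" "openin \<tau> W"
  shows "openin \<tau> (set_add {a} W)"
proof -
  have "continuous_map \<tau> \<tau> (\<lambda>y. neg a \<oplus> y)"
    using assms by (intro continuous_map_add) auto
  then show ?thesis
    using assms openin_subset[of \<tau> W]
    by (auto simp: set_add_singleton intro: openin_continuous_map_preimage)
qed

text \<open>The sum is a union of left translates of \<open>W\<close>, so \<open>A\<close> may be
  arbitrary.\<close>

lemma openin_set_add: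
  assumes "A \<subseteq> topspace \<tau>" "openin \<tau> W"
  shows "openin \<tau> (set_add A W)"
proof -
  have "openin \<tau> (\<Union>a\<in>A. set_add {a} W)"
    using assms by (intro openin_Union) (auto intro: openin_set_add_singleton)
  then show ?thesis
    by (simp flip: set_add_UN)
qed

lemma open_nbhds_add:
  assumes "openin \<tau> W" "x \<in> topspace \<tau>" "y \<in> topspace \<tau>" "x \<oplus> y \<in> W"
  obtains A B where "openin \<tau> A" "openin \<tau> B" "x \<in> A" "y \<in> B" "set_add A B \<subseteq> W"
proof -
  have "openin (prod_topology \<tau> \<tau>) {z \<in> topspace (prod_topology \<tau> \<tau>). (case z of (x, y) \<Rightarrow> x \<oplus> y) \<in> W}"
    using continuous_add assms(1) by (rule openin_continuous_map_preimage)
  from this[unfolded openin_prod_topology_alt, rule_format, of x y] assms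
  obtain A B where "openin \<tau> A" "openin \<tau> B" "x \<in> A" "y \<in> B"
    "A \<times> B \<subseteq> {z \<in> topspace (prod_topology \<tau> \<tau>). (case z of (x, y) \<Rightarrow> x \<oplus> y) \<in> W}"
    by auto
  then show thesis
    by (intro that[of A B]) (auto simp: set_add_def)
qed

end

context strongly_topological_gyrogroup
begin

text \<open>Members of \<open>\<U>\<close> need not be open. Hence two sets are returned: an
  invariant \<open>V\<close> for regrouping sums and an open \<open>O'\<close> inside it for
  topological arguments.\<close>

lemma invariant_nbhd:
  assumes "openin \<tau> N" "zero \<in> N"
  obtains V O' where "V \<in> \<U>" "gyr_invariant_set V" "V \<subseteq> N" "openin \<tau> O'" "zero \<in> O'" "O' \<subseteq> V"
proof -
  have "neighbourhood_base_at zero (\<lambda>U. U \<in> \<U>) \<tau>"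
    using base by (simp add: nbhd_base_zero_def)
  then obtain V where V: "V \<in> \<U>" "V \<subseteq> N"
    using assms unfolding neighbourhood_base_at_def by meson
  then have VG: "V \<subseteq> topspace \<tau>" "\<exists>O'. openin \<tau> O' \<and> zero \<in> O' \<and> O' \<subseteq> V"
    using base by (auto simp: nbhd_base_zero_def)
  then have "gyr_invariant_set V"
    using gyr_invariant[OF V(1)] by (simp add: gyr_invariant_set_def)
  then show thesis
    using that V VG by metis
qed

end

section \<open>The quotient space\<close>

text \<open>Collects the hypotheses on the base and on \<open>H\<close> in the form suited to
  complex sums. Invariance of \<open>H\<close> is inherited from the members of \<open>\<U>\<close>
  whose intersection it is.\<close>

locale neutral_quotient = strongly_topological_gyrogroup \<tau> add gyr \<U>
  for \<tau> :: "'a topology" and add :: "'a \<Rightarrow> 'a \<Rightarrow> 'a"  (infixl \<open>\<oplus>\<close> 65)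
    and gyr :: "'a \<Rightarrow> 'a \<Rightarrow> 'a \<Rightarrow> 'a" and \<U> :: "'a set set" +
  fixes H :: "'a set"
  assumes neg_base: "U \<in> \<U> \<Longrightarrow> neg ` U \<subseteq> U"
    and H_invariant: "gyr_invariant_set H"
    and zero_H: "zero \<in> H"
    and H_add: "set_add H H \<subseteq> H"
    and neg_H: "neg ` H \<subseteq> H"
    and neutral_H: "neutral H"
begin

lemma H_subset: "H \<subseteq> topspace \<tau>"
  using H_invariant by (simp add: gyr_invariant_set_def)

lemma neutral_nbhd:
  assumes "openin \<tau> U" "zero \<in> U"
  obtains V where "openin \<tau> V" "zero \<in> V" "set_add H V \<subseteq> set_add U H"
  using neutral_H assms unfolding neutral_def by blast

section \<open>Open sets saturated with respect to \<open>H\<close>\<close>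

definition saturated :: "'a set \<Rightarrow> bool" where
  "saturated W \<longleftrightarrow> openin \<tau> W \<and> set_add W H \<subseteq> W"

lemma saturated_openin: "saturated W \<Longrightarrow> openin \<tau> W"
  by (simp add: saturated_def)

lemma saturated_subset: "saturated W \<Longrightarrow> W \<subseteq> topspace \<tau>"
  by (simp add: saturated_def openin_subset)

lemma saturated_add: "saturated W \<Longrightarrow> w \<in> W \<Longrightarrow> h \<in> H \<Longrightarrow> w \<oplus> h \<in> W"
  unfolding saturated_def by (blast intro: set_addI)

lemma saturated_Int:
  assumes "saturated A" "saturated B"
  shows "saturated (A \<inter> B)"
  using assms set_add_mono[of "A \<inter> B" A H H] set_add_mono[of "A \<inter> B" B H H]
  by (simp add: saturated_def openin_Int) blast

lemma set_add_H_H: "A \<subseteq> topspace \<tau> \<Longrightarrow> set_add (set_add A H) H \<subseteq> set_add A H"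
  using set_add_assoc[OF _ H_subset H_invariant] H_add by (simp add: set_add_mono)

lemma saturated_set_add:
  assumes "A \<subseteq> topspace \<tau>" "saturated W"
  shows "saturated (set_add A W)"
  using assms set_add_assoc[OF assms(1) saturated_subset[OF assms(2)] H_invariant]
  by (simp add: saturated_def openin_set_add set_add_mono)

text \<open>The summand \<open>h\<close> is undone on the right by \<open>gyr a h (neg h)\<close>,
  which lies in \<open>H\<close> by invariance.\<close>

lemma add_H_cancel:
  assumes "saturated W" "a \<in> topspace \<tau>" "h \<in> H" "a \<oplus> h \<in> W"
  shows "a \<in> W"
proof -
  have h: "h \<in> topspace \<tau>" "neg h \<in> H"
    using assms H_subset neg_H by auto
  have "a = (a \<oplus> h) \<oplus> gyr a h (neg h)"
    using G3[of a h "neg h"] assms h by simp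
  moreover have "gyr a h (neg h) \<in> H"
    using gyr_invariant_set_mem[OF H_invariant] assms h by blast
  ultimately show ?thesis
    using saturated_add[OF assms(1,4)] by metis
qed

text \<open>Openness comes from neutrality: in a neighbourhood of \<open>s \<oplus> h\<close> the
  element \<open>h\<close> stands to the left of a small set and is moved to its right as a member
  of \<open>H\<close>.\<close>

lemma saturated_set_add_H:
  assumes "openin \<tau> S"
  shows "saturated (set_add S H)"
proof -
  have SG: "S \<subseteq> topspace \<tau>"
    using assms by (rule openin_subset)
  have "\<exists>T. openin \<tau> T \<and> z \<in> T \<and> T \<subseteq> set_add S H" if mem: "z \<in> set_add S H" for z
  proof -
    obtain s h where z: "z = s \<oplus> h" "s \<in> S" "h \<in> H"
      using mem by (auto simp: set_add_def)
    then have G: "s \<in> topspace \<tau>" "h \<in> topspace \<tau>"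
      using SG H_subset by auto
    obtain A V where V: "openin \<tau> A" "openin \<tau> V" "s \<in> A" "zero \<in> V" "set_add A V \<subseteq> S"
      by (rule open_nbhds_add[OF assms, of s zero]) (use G z in auto)
    obtain N where N: "openin \<tau> N" "zero \<in> N" "set_add H N \<subseteq> set_add V H"
      using neutral_nbhd V by blast
    \<comment> \<open>A translate of \<open>O'\<close> will be the open neighbourhood of
      \<open>z\<close>; invariance of \<open>V'\<close> permits regrouping
      \<open>(s \<oplus> h) \<oplus> V'\<close>.\<close>
    obtain V' O' where V': "gyr_invariant_set V'" "V' \<subseteq> N" "openin \<tau> O'" "zero \<in> O'" "O' \<subseteq> V'"
      using invariant_nbhd[OF N(1,2)] by metis
    have "set_add {z} O' \<subseteq> set_add (set_add {s} {h}) V'"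
      using V' z by (intro set_add_mono) (auto simp: set_add_def)
    also have "\<dots> = set_add {s} (set_add {h} V')"
      using G V' by (intro set_add_assoc) auto
    also have "\<dots> \<subseteq> set_add {s} (set_add H N)"
      using z V' by (intro set_add_mono) auto
    also have "\<dots> \<subseteq> set_add {s} (set_add V H)"
      by (intro set_add_mono N order_refl)
    also have "\<dots> = set_add (set_add {s} V) H"
      using G openin_subset[OF V(2)] H_invariant by (intro set_add_assoc[symmetric]) auto
    also have "\<dots> \<subseteq> set_add S H"
      using V set_add_mono[of "{s}" A V V] by (intro set_add_mono) auto
    finally have "set_add {z} O' \<subseteq> set_add S H" .
    moreover have "openin \<tau> (set_add {z} O')"
      using V' z G by (intro openin_set_add_singleton) (auto simp: closed)
    moreover have "z \<in> set_add {z} O'"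
      using set_addI[of z "{z}" zero O'] V' z G by (simp add: closed)
    ultimately show ?thesis by blast
  qed
  then have "openin \<tau> (set_add S H)"
    by (subst openin_subopen) blast
  then show ?thesis
    using set_add_H_H[OF SG] by (simp add: saturated_def)
qed

section \<open>Estimates for complex sums modulo \<open>H\<close>\<close>

lemma subset_set_add_H: "A \<subseteq> topspace \<tau> \<Longrightarrow> A \<subseteq> set_add A H"
  using zero_H by (force simp: set_add_def)

text \<open>The sum lies in \<open>(H \<oplus> V) \<oplus> (V \<oplus> H)\<close>. Regrouping joins
  the two copies of \<open>V\<close> into a subset of \<open>N\<close>, and the hypothesis on
  \<open>N\<close> moves the left \<open>H\<close> to the right, where it merges with the other
  one.\<close>

lemma neg_add_subset:
  assumes V: "gyr_invariant_set V" "neg ` V \<subseteq> V" "set_add V V \<subseteq> N"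
    and U: "U \<subseteq> topspace \<tau>" "set_add H N \<subseteq> set_add U H"
    and W: "W \<subseteq> set_add V H"
  shows "set_add (neg ` W) W \<subseteq> set_add U H"
proof -
  have VG: "V \<subseteq> topspace \<tau>"
    using V by (simp add: gyr_invariant_set_def)
  have "neg ` W \<subseteq> set_add H V"
    using neg_set_add[OF V(1,2) H_invariant neg_H] W by blast
  then have "set_add (neg ` W) W \<subseteq> set_add (set_add H V) (set_add V H)"
    using W by (rule set_add_mono)
  also have "\<dots> = set_add (set_add (set_add H V) V) H"
    using VG H_subset H_invariant by (intro set_add_assoc[symmetric] set_add_closed) auto
  also have "\<dots> = set_add (set_add H (set_add V V)) H"
    using VG H_subset V(1) by (simp add: set_add_assoc)
  also have "\<dots> \<subseteq> set_add (set_add H N) H"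
    using V(3) by (intro set_add_mono) auto
  also have "\<dots> \<subseteq> set_add (set_add U H) H"
    by (intro set_add_mono U order_refl)
  also have "\<dots> \<subseteq> set_add U H"
    using U by (intro set_add_H_H)
  finally show ?thesis .
qed

text \<open>The \<open>H\<close> between \<open>Y\<close> and \<open>V\<close> is moved to the right
  at the price of enlarging \<open>V\<close> to \<open>U\<close>. Only \<open>V\<close> has to be
  invariant.\<close>

lemma set_add_H_subset:
  assumes Y: "Y \<subseteq> topspace \<tau>" and V: "gyr_invariant_set V"
    and U: "U \<subseteq> topspace \<tau>" "set_add H V \<subseteq> set_add U H"
  shows "set_add (set_add Y H) (set_add V H) \<subseteq> set_add (set_add Y U) H"
proof -
  have VG: "V \<subseteq> topspace \<tau>"
    using V by (simp add: gyr_invariant_set_def)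
  have "set_add (set_add Y H) (set_add V H) = set_add (set_add (set_add Y H) V) H"
    using Y VG H_subset H_invariant by (intro set_add_assoc[symmetric] set_add_closed) auto
  also have "\<dots> = set_add (set_add Y (set_add H V)) H"
    using Y H_subset V by (simp add: set_add_assoc)
  also have "\<dots> \<subseteq> set_add (set_add Y (set_add U H)) H"
    by (intro set_add_mono U order_refl)
  also have "\<dots> = set_add (set_add (set_add Y U) H) H"
    using Y U H_invariant by (simp add: set_add_assoc)
  also have "\<dots> \<subseteq> set_add (set_add Y U) H"
    using Y U by (intro set_add_H_H set_add_closed)
  finally show ?thesis .
qed

text \<open>The neighbourhoods are chosen from \<open>Z\<close> inwards. \<open>W2\<close> comes
  before \<open>W1\<close>, since the region from which \<open>W1\<close> is taken depends on the
  sum built from \<open>W2\<close>.\<close>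

lemma small_saturated_set:
  assumes \<P>: "\<And>W. W \<in> \<P> \<Longrightarrow> saturated W \<and> W \<noteq> {}"
    and dense: "\<And>Z. saturated Z \<Longrightarrow> Z \<noteq> {} \<Longrightarrow> \<exists>W\<in>\<P>. W \<subseteq> Z"
    and Z: "saturated Z" "x \<in> Z"
  shows "\<exists>W1\<in>\<P>. \<exists>W2\<in>\<P>. x \<in> set_add W1 (set_add (neg ` W2) W2) \<and>
    set_add W1 (set_add (neg ` W2) W2) \<subseteq> Z"
proof -
  have x: "x \<in> topspace \<tau>"
    using Z saturated_subset by blast
  obtain Y0 U2 where U2: "openin \<tau> Y0" "openin \<tau> U2" "x \<in> Y0" "zero \<in> U2" "set_add Y0 U2 \<subseteq> Z"
    using open_nbhds_add[of Z x zero] Z x saturated_openin by auto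
  \<comment> \<open>\<open>U1\<close> will absorb the copy of \<open>H\<close> that stands between
    \<open>Y0\<close> and the sum built from \<open>W2\<close>.\<close>
  obtain N2 where N2: "openin \<tau> N2" "zero \<in> N2" "set_add H N2 \<subseteq> set_add U2 H"
    using neutral_nbhd U2 by blast
  obtain U1 O1 where U1: "gyr_invariant_set U1" "U1 \<subseteq> N2" "openin \<tau> O1" "zero \<in> O1" "O1 \<subseteq> U1"
    using invariant_nbhd[OF N2(1,2)] by metis
  \<comment> \<open>From here on the sets are shrunk so that \<open>set_add V V\<close> lies in
    \<open>N\<close>, as \<open>neg_add_subset\<close> demands; neutrality is applied to
    \<open>O1\<close> because it requires an open set.\<close>
  obtain N where N: "openin \<tau> N" "zero \<in> N" "set_add H N \<subseteq> set_add O1 H"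
    using neutral_nbhd U1 by blast
  obtain A B where AB: "openin \<tau> A" "openin \<tau> B" "zero \<in> A" "zero \<in> B" "set_add A B \<subseteq> N"
    using open_nbhds_add[of N zero zero] N by auto
  obtain V O2 where V: "V \<in> \<U>" "gyr_invariant_set V" "V \<subseteq> A \<inter> B" "openin \<tau> O2" "zero \<in> O2" "O2 \<subseteq> V"
    using invariant_nbhd[of "A \<inter> B"] AB by (metis IntI openin_Int)
  have "zero \<in> set_add O2 H"
    using set_addI[OF V(5) zero_H] by simp
  then obtain W2 where W2: "W2 \<in> \<P>" "W2 \<subseteq> set_add O2 H"
    using dense[OF saturated_set_add_H[OF V(4)]] by blast
  let ?B = "set_add (neg ` W2) W2"
  have W2G: "saturated W2" "W2 \<subseteq> topspace \<tau>" "W2 \<noteq> {}"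
    using \<P>[OF W2(1)] saturated_subset by auto
  have "?B \<subseteq> set_add O1 H"
  proof (rule neg_add_subset)
    show "set_add V V \<subseteq> N"
      using set_add_mono[of V A V B] V AB by blast
    show "W2 \<subseteq> set_add V H"
      using set_add_mono[of O2 V H H] W2 V by blast
  qed (use V neg_base openin_subset[OF U1(3)] N in auto)
  then have B_sub: "?B \<subseteq> set_add U1 H"
    using set_add_mono[of O1 U1 H H] U1 by blast
  have B_sat: "saturated ?B"
    using W2G by (intro saturated_set_add) auto
  have B_zero: "zero \<in> ?B"
  proof -
    obtain w where w: "w \<in> W2"
      using W2G by blast
    then have "neg w \<oplus> w \<in> ?B"
      by (intro set_addI) auto
    then show ?thesis
      using w W2G by auto
  qed
  \<comment> \<open>Each \<open>y\<close> in this set satisfies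
    \<open>x = y \<oplus> (neg y \<oplus> x)\<close> with the second summand in \<open>?B\<close>.
    The set contains \<open>x\<close> because \<open>zero\<close> lies in \<open>?B\<close>.\<close>
  let ?Y = "Y0 \<inter> {y \<in> topspace \<tau>. neg y \<oplus> x \<in> ?B}"
  have "continuous_map \<tau> \<tau> (\<lambda>y. neg y \<oplus> x)"
    using x by (intro continuous_map_add continuous_neg) auto
  then have Y: "openin \<tau> ?Y"
    using U2 saturated_openin[OF B_sat]
    by (intro openin_Int openin_continuous_map_preimage[where Y = \<tau>]) auto
  have "x \<in> ?Y"
    using x U2 B_zero by simp
  then have "set_add ?Y H \<noteq> {}"
    using subset_set_add_H[OF openin_subset[OF Y]] by blast
  then obtain W1 where W1: "W1 \<in> \<P>" "W1 \<subseteq> set_add ?Y H"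
    using dense[OF saturated_set_add_H[OF Y]] by blast
  have W1G: "saturated W1" "W1 \<noteq> {}"
    using \<P>[OF W1(1)] by auto
  \<comment> \<open>\<open>W1\<close> is contained only in \<open>?Y \<oplus> H\<close>, so a point
    of it may differ from its \<open>y\<close> by an element of \<open>H\<close>; saturation of
    \<open>W1\<close> brings \<open>y\<close> itself into \<open>W1\<close>.\<close>
  then obtain y h where y: "y \<in> ?Y" "h \<in> H" "y \<oplus> h \<in> W1"
    using W1 by (fastforce simp: set_add_def)
  then have "y \<in> W1"
    using add_H_cancel[OF W1G(1)] by blast
  then have "y \<oplus> (neg y \<oplus> x) \<in> set_add W1 ?B"
    using y by (blast intro: set_addI)
  then have "x \<in> set_add W1 ?B"
    using x y by simp
  moreover have "set_add W1 ?B \<subseteq> Z"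
  proof -
    have "set_add W1 ?B \<subseteq> set_add (set_add Y0 H) (set_add U1 H)"
      by (intro set_add_mono B_sub order_trans[OF W1(2)]) auto
    also have "\<dots> \<subseteq> set_add (set_add Y0 U2) H"
      using U1 U2(1,2) N2 set_add_mono[of H H U1 N2] openin_subset[of \<tau>]
      by (intro set_add_H_subset) auto
    also have "\<dots> \<subseteq> set_add Z H"
      using U2 by (intro set_add_mono) auto
    also have "\<dots> \<subseteq> Z"
      using Z by (simp add: saturated_def)
    finally show ?thesis .
  qed
  ultimately show ?thesis
    using W1 W2 by blast
qed

section \<open>Saturated sets and open subsets of the quotient space\<close>

definition preim :: "'a set set \<Rightarrow> 'a set" where
  "preim O' = {a \<in> topspace \<tau>. coset H a \<in> O'}"

text \<open>Follows from \<open>h \<oplus> H = H\<close> by regrouping, with the invariant set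
  \<open>H\<close> as third summand.\<close>

lemma coset_add_H:
  assumes "a \<in> topspace \<tau>" "h \<in> H"
  shows "coset H (a \<oplus> h) = coset H a"
proof -
  have h: "h \<in> topspace \<tau>" "neg h \<in> H"
    using assms H_subset neg_H by auto
  have "set_add {h} H = H"
  proof
    show "set_add {h} H \<subseteq> H"
      using set_add_mono[of "{h}" H H H] H_add assms by blast
    have "neg h \<oplus> k \<in> H" if "k \<in> H" for k
      using H_add set_addI[OF h(2) that] by blast
    then show "H \<subseteq> set_add {h} H"
      using h H_subset by (auto simp: set_add_singleton)
  qed
  moreover have "coset H b = set_add {b} H" for b
    by (auto simp: coset_def set_add_def)
  moreover have "set_add {a \<oplus> h} H = set_add {a} (set_add {h} H)"
    using set_add_assoc[of "{a}" "{h}" H] assms h H_invariant by (simp add: set_add_def)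
  ultimately show ?thesis
    by simp
qed

lemma mem_coset_self: "a \<in> topspace \<tau> \<Longrightarrow> a \<in> coset H a"
  using zero_H by (force simp: coset_def)

lemma saturated_preim: "openin (quotient_space H) O' \<Longrightarrow> saturated (preim O')"
  using H_subset by (auto simp: saturated_def openin_quotient_space preim_def set_add_def coset_add_H
      closed subset_iff)

lemma preim_image:
  assumes "saturated W"
  shows "preim (coset H ` W) = W"
proof (intro equalityI subsetI)
  fix a assume "a \<in> preim (coset H ` W)"
  then obtain w where "w \<in> W" "coset H a = coset H w" "a \<in> topspace \<tau>"
    by (auto simp: preim_def)
  moreover from this have "a \<in> coset H w"
    using mem_coset_self by metis
  ultimately show "a \<in> W"
    using saturated_add[OF assms] by (auto simp: coset_def)
qed (use saturated_subset[OF assms] in \<open>auto simp: preim_def\<close>)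

lemma openin_image_saturated: "saturated W \<Longrightarrow> openin (quotient_space H) (coset H ` W)"
  using preim_image[of W] saturated_subset[of W] saturated_openin[of W]
  by (auto simp: openin_quotient_space preim_def cosets_def)

lemma image_preim: "openin (quotient_space H) O' \<Longrightarrow> coset H ` preim O' = O'"
  by (auto simp: openin_quotient_space preim_def cosets_def)

lemma preim_mono: "A \<subseteq> B \<Longrightarrow> preim A \<subseteq> preim B"
  by (auto simp: preim_def)

text \<open>The two facts have the form of the first two premises of
  \<open>small_saturated_set\<close>.\<close>

lemma saturated_pi_base:
  assumes "is_pi_base (quotient_space H) \<P>"
  shows "W \<in> preim ` \<P> \<Longrightarrow> saturated W \<and> W \<noteq> {}"
    and "saturated Z \<Longrightarrow> Z \<noteq> {} \<Longrightarrow> \<exists>W\<in>preim ` \<P>. W \<subseteq> Z"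
proof -
  assume "W \<in> preim ` \<P>"
  then obtain O' where O': "O' \<in> \<P>" "W = preim O'"
    by blast
  then have "openin (quotient_space H) O'" "O' \<noteq> {}"
    using assms by (auto simp: is_pi_base_def)
  then show "saturated W \<and> W \<noteq> {}"
    using O' saturated_preim[of O'] image_preim[of O'] by auto
next
  assume Z: "saturated Z" "Z \<noteq> {}"
  then have "openin (quotient_space H) (coset H ` Z)" "coset H ` Z \<noteq> {}"
    by (auto intro: openin_image_saturated)
  then obtain O' where O': "O' \<in> \<P>" "O' \<subseteq> coset H ` Z"
    using assms unfolding is_pi_base_def by meson
  then have "preim O' \<subseteq> Z"
    using preim_mono[OF O'(2)] preim_image[OF Z(1)] by simp
  then show "\<exists>W\<in>preim ` \<P>. W \<subseteq> Z"
    using O' by blast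
qed

lemma is_base_saturatedI:
  assumes "\<And>W. W \<in> \<B> \<Longrightarrow> saturated W"
    and "\<And>Z x. saturated Z \<Longrightarrow> x \<in> Z \<Longrightarrow> \<exists>W\<in>\<B>. x \<in> W \<and> W \<subseteq> Z"
  shows "is_base (quotient_space H) ((`) (coset H) ` \<B>)"
  unfolding is_base_def
proof (intro conjI ballI allI impI)
  fix O' c assume *: "openin (quotient_space H) O' \<and> c \<in> O'"
  then have O': "coset H ` preim O' = O'" "saturated (preim O')"
    by (auto simp: image_preim saturated_preim)
  then obtain x where x: "x \<in> preim O'" "c = coset H x"
    using * by blast
  then obtain W where W: "W \<in> \<B>" "x \<in> W" "W \<subseteq> preim O'"
    using assms(2)[OF O'(2)] by blast
  then have "c \<in> coset H ` W" "coset H ` W \<subseteq> O'"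
    using x O' by auto
  then show "\<exists>V\<in>(`) (coset H) ` \<B>. c \<in> V \<and> V \<subseteq> O'"
    using W by blast
qed (use assms(1) in \<open>blast intro: openin_image_saturated\<close>)

lemma base_of_pi_base:
  assumes "is_pi_base (quotient_space H) \<P>"
  obtains \<B> where "is_base (quotient_space H) \<B>" "|\<B>| \<le>o |\<P> \<times> \<P>|"
proof -
  let ?E = "\<lambda>(P, Q). set_add (preim P) (set_add (neg ` preim Q) (preim Q))"
  note \<P> = saturated_pi_base[OF assms]
  have "is_base (quotient_space H) ((`) (coset H) ` ?E ` (\<P> \<times> \<P>))"
  proof (rule is_base_saturatedI)
    fix W assume "W \<in> ?E ` (\<P> \<times> \<P>)"
    then obtain P Q where PQ: "P \<in> \<P>" "Q \<in> \<P>" "W = ?E (P, Q)"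
      by blast
    then have "saturated (preim P)" "saturated (preim Q)"
      using \<P>(1) by blast+
    moreover from this have "preim P \<subseteq> topspace \<tau>" "neg ` preim Q \<subseteq> topspace \<tau>"
      using saturated_subset by fastforce+
    ultimately show "saturated W"
      using PQ by (simp add: saturated_set_add)
  next
    fix Z x assume "saturated Z" "x \<in> Z"
    from small_saturated_set[OF \<P> this] show "\<exists>W\<in>?E ` (\<P> \<times> \<P>). x \<in> W \<and> W \<subseteq> Z"
      by fastforce
  qed
  moreover have "|(`) (coset H) ` ?E ` (\<P> \<times> \<P>)| \<le>o |\<P> \<times> \<P>|"
    unfolding image_image by (rule card_of_image)
  ultimately show thesis
    by (rule that)
qed

section \<open>Minimal saturated sets and finite \<pi>-bases\<close>

definition minimal_saturated :: "'a set \<Rightarrow> bool" where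
  "minimal_saturated W \<longleftrightarrow> saturated W \<and> W \<noteq> {} \<and>
     (\<forall>Z. saturated Z \<and> Z \<noteq> {} \<and> Z \<subseteq> W \<longrightarrow> Z = W)"

text \<open>Translation by \<open>neg a\<close> inverts translation by \<open>a\<close>, and both
  preserve saturated sets, so a smaller set inside the translate would pull back to one inside
  \<open>W\<close>.\<close>

lemma minimal_saturated_translate:
  assumes W: "minimal_saturated W" and a: "a \<in> topspace \<tau>"
  shows "minimal_saturated (set_add {a} W)"
proof -
  have sat: "saturated W" "W \<subseteq> topspace \<tau>" "W \<noteq> {}"
    using W saturated_subset by (auto simp: minimal_saturated_def)
  have "Z = set_add {a} W" if Z: "saturated Z" "Z \<noteq> {}" "Z \<subseteq> set_add {a} W" for Z
  proof -
    have ZG: "Z \<subseteq> topspace \<tau>"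
      using Z(1) by (rule saturated_subset)
    have "set_add {neg a} Z \<subseteq> W"
      using Z(3) sat a by (auto simp: set_add_def subset_iff)
    moreover have "saturated (set_add {neg a} Z)" "set_add {neg a} Z \<noteq> {}"
      using Z a by (auto intro!: saturated_set_add) (auto simp: set_add_def)
    ultimately have "set_add {neg a} Z = W"
      using W unfolding minimal_saturated_def by blast
    then have "set_add {a} W \<subseteq> Z"
      using ZG a by (auto simp: set_add_def subset_iff)
    then show ?thesis
      using Z by blast
  qed
  then show ?thesis
    using sat a unfolding minimal_saturated_def
    by (auto intro!: saturated_set_add) (auto simp: set_add_def)
qed

lemma base_of_finite_pi_base:
  assumes "is_pi_base (quotient_space H) \<P>" "finite \<P>"
  obtains \<B> where "is_base (quotient_space H) \<B>" "|\<B>| \<le>o |\<P>|"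
proof -
  note \<P> = saturated_pi_base[OF assms(1)]
  let ?M = "{W \<in> preim ` \<P>. minimal_saturated W}"
  have M: "W \<in> ?M" if "minimal_saturated W" for W
  proof -
    have W: "saturated W" "W \<noteq> {}"
      using that by (auto simp: minimal_saturated_def)
    obtain W' where W': "W' \<in> preim ` \<P>" "W' \<subseteq> W"
      using \<P>(2)[OF W] by blast
    then have "W' = W"
      using \<P>(1)[OF W'(1)] that unfolding minimal_saturated_def by blast
    then show ?thesis
      using W' that by blast
  qed
  have "saturated (topspace \<tau>)" "topspace \<tau> \<noteq> {}"
    using set_add_closed[OF _ H_subset] nonempty by (auto simp: saturated_def)
  then have "preim ` \<P> \<noteq> {}"
    using \<P>(2) by blast
  then obtain W where W: "W \<in> preim ` \<P>" "\<And>W'. W' \<in> preim ` \<P> \<Longrightarrow> W' \<subseteq> W \<Longrightarrow> W = W'"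
    using finite_has_minimal[of "preim ` \<P>"] assms(2) by auto
  \<comment> \<open>Minimality within the finite family extends to all nonempty saturated sets,
    since each of them contains a member of the family.\<close>
  have "Z = W" if Z: "saturated Z" "Z \<noteq> {}" "Z \<subseteq> W" for Z
  proof -
    obtain W' where "W' \<in> preim ` \<P>" "W' \<subseteq> Z"
      using \<P>(2)[OF Z(1,2)] by blast
    then show ?thesis
      using W(2) Z(3) by blast
  qed
  then have min: "minimal_saturated W"
    using \<P>(1)[OF W(1)] unfolding minimal_saturated_def by blast
  have "is_base (quotient_space H) ((`) (coset H) ` ?M)"
  proof (rule is_base_saturatedI)
    fix Z x assume Z: "saturated Z" "x \<in> Z"
    obtain w where w: "w \<in> W" "w \<in> topspace \<tau>"
      using \<P>(1)[OF W(1)] saturated_subset by blast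
    have x: "x \<in> topspace \<tau>"
      using Z saturated_subset by blast
    \<comment> \<open>The first translation carries \<open>w\<close> to \<open>zero\<close>, the
      second carries \<open>zero\<close> to \<open>x\<close>, so this minimal set contains
      \<open>x\<close>.\<close>
    let ?W = "set_add {x} (set_add {neg w} W)"
    have W': "minimal_saturated ?W"
      using min w x by (intro minimal_saturated_translate) auto
    have "x \<oplus> (neg w \<oplus> w) \<in> ?W"
      using w by (intro set_addI) auto
    then have xW: "x \<in> ?W"
      using w x by simp
    have "saturated (Z \<inter> ?W)"
      using Z(1) W' by (intro saturated_Int) (auto simp: minimal_saturated_def)
    \<comment> \<open>The intersection contains \<open>x\<close>, so it is a nonempty saturated
      subset of a minimal one.\<close>
    then have "Z \<inter> ?W = ?W"
      using W' Z xW unfolding minimal_saturated_def by blast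
    then show "\<exists>W\<in>?M. x \<in> W \<and> W \<subseteq> Z"
      using M[OF W'] xW by blast
  qed (simp add: minimal_saturated_def)
  moreover have "|(`) (coset H) ` ?M| \<le>o |\<P>|"
  proof -
    have "|(`) (coset H) ` ?M| \<le>o |?M|"
      by (rule card_of_image)
    also have "|?M| \<le>o |preim ` \<P>|"
      by (intro card_of_mono1) auto
    also have "|preim ` \<P>| \<le>o |\<P>|"
      by (rule card_of_image)
    finally show ?thesis .
  qed
  ultimately show thesis
    by (rule that)
qed

lemma base_card_le_pi_base:
  assumes "is_pi_base (quotient_space H) \<P>"
  obtains \<B> where "is_base (quotient_space H) \<B>" "|\<B>| \<le>o |\<P>|"
proof (cases "finite \<P>")
  case True
  then show thesis
    using base_of_finite_pi_base[OF assms] that by blast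
next
  case False
  obtain \<B> where \<B>: "is_base (quotient_space H) \<B>" "|\<B>| \<le>o |\<P> \<times> \<P>|"
    by (rule base_of_pi_base[OF assms])
  have "|\<P> \<times> \<P>| =o |\<P>|"
    using False by (rule card_of_Times_same_infinite)
  with \<B> show thesis
    by (intro that) (auto intro: ordLeq_ordIso_trans)
qed

end

section \<open>Weight and \<open>\<pi>\<close>-weight\<close>

lemma is_pi_base_of_base:
  assumes "is_base X \<B>"
  shows "is_pi_base X (\<B> - {{}})"
  unfolding is_pi_base_def
proof (intro conjI allI impI)
  fix U assume U: "openin X U \<and> U \<noteq> {}"
  then obtain x where "x \<in> U"
    by blast
  then obtain V where "V \<in> \<B>" "x \<in> V" "V \<subseteq> U"
    using assms U unfolding is_base_def by meson
  then show "\<exists>V\<in>\<B> - {{}}. V \<subseteq> U"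
    by blast
qed (use assms in \<open>auto simp: is_base_def\<close>)

text \<open>Deleting the empty set from a base leaves a \<pi>-base, which gives one inequality in
  every space; the assumption supplies the other.\<close>

lemma pi_weight_eq_weightI:
  assumes "\<And>\<P>. is_pi_base X \<P> \<Longrightarrow> \<exists>\<B>. is_base X \<B> \<and> |\<B>| \<le>o |\<P>|"
  shows "pi_weight X =o weight X"
proof -
  have "{\<B>. is_base X \<B>} \<noteq> {}"
    using is_base_openin by blast
  then obtain \<B> where \<B>: "is_base X \<B>" "weight X = |\<B>|" "\<And>\<B>'. is_base X \<B>' \<Longrightarrow> |\<B>| \<le>o |\<B>'|"
    using least_card[of "{\<B>. is_base X \<B>}"] unfolding weight_def by (metis mem_Collect_eq)
  have "{\<P>. is_pi_base X \<P>} \<noteq> {}"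
    using is_pi_base_openin by blast
  then obtain \<P> where \<P>: "is_pi_base X \<P>" "pi_weight X = |\<P>|"
      "\<And>\<P>'. is_pi_base X \<P>' \<Longrightarrow> |\<P>| \<le>o |\<P>'|"
    using least_card[of "{\<P>. is_pi_base X \<P>}"] unfolding pi_weight_def by (metis mem_Collect_eq)
  have "|\<P>| \<le>o |\<B> - {{}}|"
    using \<P>(3) is_pi_base_of_base[OF \<B>(1)] by blast
  also have "|\<B> - {{}}| \<le>o |\<B>|"
    by (intro card_of_mono1) auto
  finally have "|\<P>| \<le>o |\<B>|" .
  moreover have "|\<B>| \<le>o |\<P>|"
    using assms[OF \<P>(1)] \<B>(3) ordLeq_transitive by blast
  ultimately show ?thesis
    using \<P>(2) \<B>(2) by (simp add: ordIso_iff_ordLeq)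
qed

theorem theorem4p3:
  fixes \<tau> :: "'a topology"
    and add :: "'a \<Rightarrow> 'a \<Rightarrow> 'a"
    and gyr :: "'a \<Rightarrow> 'a \<Rightarrow> 'a \<Rightarrow> 'a"
    and \<U> :: "'a set set"
    and H :: "'a set"
  assumes "strongly_topological_gyrogroup \<tau> add gyr \<U>"
    and "Hausdorff_space \<tau>"
    and "\<forall>U\<in>\<U>. groupoid.symmetric (topspace \<tau>) add U"
    and "topological_gyrogroup.admissible_from \<tau> add gyr \<U> H"
    and "topological_gyrogroup.neutral \<tau> add gyr H"
  shows "pi_weight (topological_gyrogroup.quotient_space \<tau> add H) =o
         weight (topological_gyrogroup.quotient_space \<tau> add H)"
proof -
  interpret strongly_topological_gyrogroup \<tau> add gyr \<U>
    by (rule assms(1))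
  obtain U :: "nat \<Rightarrow> 'a set" where sub: "subgyrogroup H"
    and U: "\<And>n. openin \<tau> (U n)" "\<And>n. zero \<in> U n" "\<And>n. symmetric (U n)" "\<And>n. U n \<in> \<U>"
    and H: "H = (\<Inter>n. U n)"
    using assms(4) unfolding admissible_from_def by metis
  have HG: "H \<subseteq> topspace \<tau>" and "set_add H H \<subseteq> H"
    using sub by (auto simp: subgyrogroup_def set_add_def)
  moreover have "gyr_invariant_set H"
    unfolding gyr_invariant_set_def
  proof (intro conjI ballI HG)
    fix x y assume xy: "x \<in> topspace \<tau>" "y \<in> topspace \<tau>"
    \<comment> \<open>An injective map commutes with intersections over a nonempty index set; the
      index \<open>0\<close> witnesses that it is nonempty.\<close>
    have "gyr x y ` (\<Inter>n. U n) = (\<Inter>n. gyr x y ` U n)"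
      using openin_subset[OF U(1)]
      by (intro image_INT[OF gyr_inj[OF xy], where j = 0]) auto
    then show "gyr x y ` H = H"
      using gyr_invariant[OF U(4) xy] H by simp
  qed
  moreover have "neg ` H \<subseteq> H"
    using U(3) H unfolding symmetric_def by blast
  ultimately interpret neutral_quotient \<tau> add gyr \<U> H
    using assms(3,5) U(2) H by unfold_locales (auto simp: symmetric_def)
  show ?thesis
    by (rule pi_weight_eq_weightI) (metis base_card_le_pi_base)
qed

end
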